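(* Let $1<p_1\le p_2\le\cdots$ be a Beurling generalized prime number system with generalized integers $1=n_0<n_1\le n_2\le\cdots$ and $N(x)=\sum_{n_k\le x}1$. Suppose that for some $a>0$ $$\int_1^\infty\left|\frac{N(x)-ax}{x^2}\right|\,\mathrm{d}x<\infty,$$ and that $M(x):=\sum_{n_k\le x}\mu(n_k)=o(x)$ as $x\to\infty$. Then $$m(x):=\sum_{n_k\le x}\frac{\mu(n_k)}{n_k}=o(1),\quad x\to\infty.$$
   Context: The generalized integers are the elements of the multiplicative semigroup generated by the generalized primes and $1$ (each regarded as a formal product of generalized primes), listed in non-decreasing order with multiplicities. The Beurling Möbius function $\mu$ is given by $\mu(n_k)=(-1)^r$ if $n_k$ is a product of $r$ generalized primes with distinct indices, and $\mu(n_k)=0$ otherwise; equivalently, $\sum_k\mu(n_k)n_k^{-s}=1/\zeta(s)$ where $\zeta(s)=\sum_k n_k^{-s}$. *)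

theory Defs
  imports "HOL-Analysis.Analysis" "HOL-Library.Landau_Symbols" "HOL-Library.Multiset"
begin

definition beurling_primes :: "(nat \<Rightarrow> real) \<Rightarrow> bool" where
  "beurling_primes p \<longleftrightarrow> 1 < p 0 \<and> mono p \<and> filterlim p at_top sequentially"

text \<open>
  A formal product of generalized primes is a finite multiset of prime indices; the empty
  multiset is the unit.  Distinct multisets count as distinct generalized integers even when
  their values coincide.
\<close>

definition gval :: "(nat \<Rightarrow> real) \<Rightarrow> nat multiset \<Rightarrow> real" where
  "gval p A = (\<Prod>i\<in>#A. p i)"

definition gmoebius :: "nat multiset \<Rightarrow> real" where
  "gmoebius A = (if \<forall>i. count A i \<le> 1 then (-1) ^ size A else 0)"

text \<open>
  \<open>e\<close> lists every formal product exactly once, by non-decreasing value, so that the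
  \<open>k\<close>-th generalized integer is \<open>n\<^sub>k = gval p (e k)\<close>.  That \<open>n\<^sub>0 = 1 < n\<^sub>1\<close> is then automatic.
  Only the order among products of equal value is left open; the counting functions
  below do not depend on it.
\<close>

definition gint_listing :: "(nat \<Rightarrow> real) \<Rightarrow> (nat \<Rightarrow> nat multiset) \<Rightarrow> bool" where
  "gint_listing p e \<longleftrightarrow> bij e \<and> mono (\<lambda>k. gval p (e k))"

definition gN :: "(nat \<Rightarrow> real) \<Rightarrow> (nat \<Rightarrow> nat multiset) \<Rightarrow> real \<Rightarrow> real" where
  "gN p e x = (\<Sum>k | gval p (e k) \<le> x. 1)"

definition gM :: "(nat \<Rightarrow> real) \<Rightarrow> (nat \<Rightarrow> nat multiset) \<Rightarrow> real \<Rightarrow> real" where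
  "gM p e x = (\<Sum>k | gval p (e k) \<le> x. gmoebius (e k))"

definition gm :: "(nat \<Rightarrow> real) \<Rightarrow> (nat \<Rightarrow> nat multiset) \<Rightarrow> real \<Rightarrow> real" where
  "gm p e x = (\<Sum>k | gval p (e k) \<le> x. gmoebius (e k) / gval p (e k))"

end

theory Submission
  imports Defs
begin

text \<open>
  Write \<open>N(u) = a u + E(u)\<close>.  Since \<open>\<integral>\<^sub>1\<^sup>y N(u)/u du = \<Sum>\<^bsub>n\<^sub>k \<le> y\<^esub> ln (y/n\<^sub>k)\<close>, Moebius inversion
  gives \<open>\<Sum>\<^bsub>n\<^sub>k \<le> x\<^esub> \<mu>(n\<^sub>k) \<integral>\<^sub>1\<^bsup>x/n\<^sub>k\<^esup> N(u)/u du = ln x\<close>.  The part \<open>a u\<close> of \<open>N\<close> contributes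
  \<open>a (x m(x) - M(x))\<close> and the part \<open>E\<close> contributes \<open>\<integral>\<^sub>1\<^sup>x E(u)/u M(x/u) du\<close>, so that
  \<open>a (m(x) - M(x)/x) = ln x / x - \<integral>\<^sub>1\<^sup>\<infinity> E(u)/u\<^sup>2 h(x/u) du\<close> with \<open>h(v) = M(v)/v\<close>.
  As \<open>h\<close> is bounded and tends to \<open>0\<close>, dominated convergence finishes the proof.
\<close>

section \<open>Moebius summation over the divisors of a formal product\<close>

lemma finite_submultisets: "finite {A. A \<subseteq># C}"
proof (induction C)
  case (add i C)
  have "{A. A \<subseteq># add_mset i C} \<subseteq> {A. A \<subseteq># C} \<union> add_mset i ` {A. A \<subseteq># C}"
  proof
    fix A assume A: "A \<in> {A. A \<subseteq># add_mset i C}"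
    show "A \<in> {A. A \<subseteq># C} \<union> add_mset i ` {A. A \<subseteq># C}"
    proof (cases "i \<in># A")
      case True
      then obtain B where "A = add_mset i B"
        by (blast dest: multi_member_split)
      then show ?thesis
        using A by auto
    next
      case False
      have "count A j \<le> count C j" for j
        using A False mset_subset_eq_count[of A "add_mset i C" j]
        by (cases "j = i") (auto simp: not_in_iff)
      then show ?thesis
        by (simp add: subseteq_mset_def)
    qed
  qed
  then show ?case
    using add.IH by (auto intro: finite_subset)
qed simp

text \<open>Submultisets play the role of divisors. Only the squarefree ones contribute; each is
  determined by its support, so the sum runs over subsets of the support of \<open>C\<close> and is
  the expansion of a product of factors \<open>(-1) + 1\<close>, one per distinct prime index of
  \<open>C\<close>.\<close>

lemma sum_gmoebius_submultisets:
  "(\<Sum>A | A \<subseteq># C. gmoebius A) = (if C = {#} then 1 else 0)"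
proof -
  have fin: "finite {A. A \<subseteq># C}"
    by (rule finite_submultisets)
  have squarefree: "mset_set (set_mset A) = A" if "\<forall>i. count A i \<le> 1" for A :: "nat multiset"
  proof (rule multiset_eqI)
    fix i
    show "count (mset_set (set_mset A)) i = count A i"
      using that[rule_format, of i]
      by (cases "count A i") (auto simp: count_mset_set' simp flip: count_greater_zero_iff)
  qed
  have "(\<Sum>A | A \<subseteq># C. gmoebius A) = (\<Sum>A | A \<subseteq># C \<and> (\<forall>i. count A i \<le> 1). (-1) ^ size A)"
    using fin by (intro sum.mono_neutral_cong_right) (auto simp: gmoebius_def)
  also have "\<dots> = (\<Sum>S\<in>Pow (set_mset C). (-1) ^ card S)"
  proof (rule sum.reindex_bij_witness[where i = mset_set and j = set_mset])
    fix A assume A: "A \<in> {A. A \<subseteq># C \<and> (\<forall>i. count A i \<le> 1)}"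
    then show "mset_set (set_mset A) = A"
      using squarefree by blast
    then show "(-1 :: real) ^ card (set_mset A) = (-1) ^ size A"
      by (metis size_mset_set)
    show "set_mset A \<in> Pow (set_mset C)"
      using A by (auto dest: mset_subset_eqD)
  next
    fix S assume S: "S \<in> Pow (set_mset C)"
    then have "finite S"
      by (auto intro: finite_subset)
    then show "set_mset (mset_set S) = S"
      by simp
    show "mset_set S \<in> {A. A \<subseteq># C \<and> (\<forall>i. count A i \<le> 1)}"
      using S \<open>finite S\<close>
      by (auto simp: count_mset_set' subseteq_mset_def Suc_le_eq)
  qed
  also have "\<dots> = (\<Prod>i\<in>set_mset C. (-1) + 1)"
    by (subst prod_add) auto
  also have "\<dots> = (if C = {#} then 1 else 0)"
    by (simp add: card_gt_0_iff)
  finally show ?thesis .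
qed

lemma gval_empty [simp]: "gval p {#} = 1"
  by (simp add: gval_def)

lemma gval_union: "gval p (A + B) = gval p A * gval p B"
  by (simp add: gval_def)

section \<open>Counting functions as sums over formal products\<close>

locale beurling =
  fixes p :: "nat \<Rightarrow> real" and e :: "nat \<Rightarrow> nat multiset"
  assumes primes: "beurling_primes p" and listing: "gint_listing p e"
begin

abbreviation V :: "real \<Rightarrow> nat multiset set" where
  "V x \<equiv> {A. gval p A \<le> x}"

lemma prime_gt_1: "1 < p i"
proof -
  have "p 0 \<le> p i"
    using primes by (auto simp: beurling_primes_def mono_def)
  then show ?thesis
    using primes by (auto simp: beurling_primes_def)
qed

lemma gval_ge_1: "1 \<le> gval p A"
proof (induction A)
  case (add i A)
  then show ?case
    using mult_mono[of 1 "p i" 1 "gval p A"] prime_gt_1[of i] by (simp add: gval_def)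
qed simp

lemma gval_pos: "0 < gval p A"
  using gval_ge_1[of A] by simp

lemma V_empty: "x < 1 \<Longrightarrow> V x = {}"
  using gval_ge_1 by (auto simp: not_le intro: less_le_trans)

text \<open>Turns sums over indices into sums over formal products, where multiplication is multiset
  union and the order chosen by \<open>e\<close> is irrelevant.\<close>

lemma bij_V: "bij_betw e {k. gval p (e k) \<le> x} (V x)"
proof -
  have "bij e"
    using listing by (simp add: gint_listing_def)
  then show ?thesis
    using bij_betw_subset[of e UNIV UNIV "e -` V x"] surj_image_vimage_eq[OF bij_is_surj, of e "V x"]
    by (simp add: vimage_def)
qed

text \<open>Some power of \<open>p 0\<close> exceeds \<open>x\<close>. It occurs at a position
  \<open>k0\<close> of the listing, and by monotonicity every later value exceeds \<open>x\<close>
  too.\<close>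

lemma finite_V: "finite (V x)"
proof -
  obtain n where n: "x < p 0 ^ n"
    using real_arch_pow prime_gt_1 by blast
  have "bij e"
    using listing by (simp add: gint_listing_def)
  then obtain k0 where k0: "e k0 = replicate_mset n 0"
    by (metis bij_pointE)
  have "gval p (e k0) > x"
    using n by (simp add: k0 gval_def)
  moreover have "gval p (e k0) \<le> gval p (e k)" if "k0 \<le> k" for k
    using listing that by (auto simp: gint_listing_def mono_def)
  ultimately have "{k. gval p (e k) \<le> x} \<subseteq> {..<k0}"
    by (force simp: not_less[symmetric])
  then have "finite {k. gval p (e k) \<le> x}"
    using finite_subset by blast
  then show ?thesis
    using bij_V bij_betw_finite by blast
qed

lemma gN_eq: "gN p e x = (\<Sum>A\<in>V x. 1)"
  and gM_eq: "gM p e x = (\<Sum>A\<in>V x. gmoebius A)"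
  and gm_eq: "gm p e x = (\<Sum>A\<in>V x. gmoebius A / gval p A)"
  unfolding gN_def gM_def gm_def
  using sum.reindex_bij_betw[OF bij_V, of "\<lambda>A. 1 :: real"]
    sum.reindex_bij_betw[OF bij_V, of gmoebius]
    sum.reindex_bij_betw[OF bij_V, of "\<lambda>A. gmoebius A / gval p A"] by auto

lemma mono_gN: "mono (gN p e)"
  unfolding gN_eq by (intro monoI sum_mono2) (auto simp: finite_V)

lemma abs_gM_le_gN: "\<bar>gM p e x\<bar> \<le> gN p e x"
  unfolding gM_eq gN_eq by (intro order_trans[OF sum_abs] sum_mono) (simp add: gmoebius_def power_abs)

section \<open>The integral identity linking \<open>gm\<close> and \<open>gM\<close>\<close>

text \<open>Group the pairs by their product \<open>C = A + B\<close>: then \<open>A\<close> runs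
  over all submultisets of \<open>C\<close>, and the Moebius sum kills every term except
  \<open>C = {#}\<close>.\<close>

lemma moebius_log_sum:
  assumes "x \<ge> 1"
  shows "(\<Sum>A\<in>V x. gmoebius A * (\<Sum>B\<in>V (x / gval p A). ln (x / gval p A / gval p B))) = ln x"
proof -
  have "(\<Sum>A\<in>V x. gmoebius A * (\<Sum>B\<in>V (x / gval p A). ln (x / gval p A / gval p B)))
      = (\<Sum>(A, B)\<in>Sigma (V x) (\<lambda>A. V (x / gval p A)). gmoebius A * ln (x / gval p (A + B)))"
    by (simp add: sum_distrib_left sum.Sigma finite_V gval_union)
  also have "\<dots> = (\<Sum>(C, A)\<in>Sigma (V x) (\<lambda>C. {A. A \<subseteq># C}). gmoebius A * ln (x / gval p C))"
  proof (rule sum.reindex_bij_witness[where i = "\<lambda>(C, A). (A, C - A)" and j = "\<lambda>(A, B). (A + B, A)"])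
    fix q assume "q \<in> Sigma (V x) (\<lambda>C. {A. A \<subseteq># C})"
    then obtain C A B where q: "q = (C, A)" "C = A + B" "gval p C \<le> x"
      by (auto simp: subset_mset.le_iff_add)
    have "gval p A * 1 \<le> gval p A * gval p B"
      by (intro mult_left_mono) (use gval_ge_1[of B] gval_pos[of A] in auto)
    also have "\<dots> \<le> x"
      using q by (simp add: gval_union)
    finally show "(case q of (C, A) \<Rightarrow> (A, C - A)) \<in> Sigma (V x) (\<lambda>A. V (x / gval p A))"
      using q gval_pos[of A] by (simp add: gval_union pos_le_divide_eq mult.commute)
  qed (auto simp: gval_union field_simps gval_pos)
  also have "\<dots> = (\<Sum>C\<in>V x. (\<Sum>A | A \<subseteq># C. gmoebius A) * ln (x / gval p C))"
    by (simp add: sum_distrib_right sum.Sigma finite_V finite_submultisets)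
  also have "\<dots> = (\<Sum>C\<in>V x. if C = {#} then ln x else 0)"
    by (intro sum.cong) (auto simp: sum_gmoebius_submultisets)
  also have "\<dots> = ln x"
    using assms by (simp add: finite_V)
  finally show ?thesis .
qed

text \<open>Each \<open>B\<close> with value \<open>n\<close> contributes the integral of
  \<open>1/u\<close> over \<open>[n, y]\<close>, which is \<open>ln (y/n)\<close>.\<close>

lemma integral_error_term:
  assumes "y \<ge> 1"
  shows "has_bochner_integral lborel (\<lambda>u. (gN p e u - a * u) / u * indicator {1..y} u)
           ((\<Sum>B\<in>V y. ln (y / gval p B)) - a * (y - 1))"
proof -
  have "has_bochner_integral lborel (\<lambda>u. 1 / u * indicator {gval p B..y} u) (ln y - ln (gval p B))"
    if "B \<in> V y" for B
    using that gval_pos[of B]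
    by (intro has_bochner_integral_FTC_Icc_real) (auto intro!: derivative_eq_intros)
  moreover have "ln y - ln (gval p B) = ln (y / gval p B)" for B
    using assms gval_pos[of B] by (simp add: ln_div)
  ultimately have "has_bochner_integral lborel
      (\<lambda>u. \<Sum>B\<in>V y. 1 / u * indicator {gval p B..y} u) (\<Sum>B\<in>V y. ln (y / gval p B))"
    by (intro has_bochner_integral_sum) auto
  moreover have "has_bochner_integral lborel (\<lambda>u. a * indicator {1..y} u) (a * y - a * 1)"
    using assms
    by (intro has_bochner_integral_FTC_Icc_real) (auto intro!: derivative_eq_intros)
  ultimately have "has_bochner_integral lborel
      (\<lambda>u. (\<Sum>B\<in>V y. 1 / u * indicator {gval p B..y} u) - a * indicator {1..y} u)
      ((\<Sum>B\<in>V y. ln (y / gval p B)) - (a * y - a * 1))"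
    by (rule has_bochner_integral_diff)
  moreover have "(\<Sum>B\<in>V y. 1 / u * indicator {gval p B..y} u) - a * indicator {1..y} u
      = (gN p e u - a * u) / u * indicator {1..y} u" for u
  proof (cases "u \<in> {1..y}")
    case True
    \<comment> \<open>At \<open>u\<close> exactly the intervals that start at or before
      \<open>u\<close> are active, and there are \<open>gN p e u\<close> of them.\<close>
    then have "(\<Sum>B\<in>V y. 1 / u * indicator {gval p B..y} u) = (\<Sum>B\<in>V u. 1 / u)"
      by (intro sum.mono_neutral_cong_right) (auto simp: finite_V)
    then show ?thesis
      using True by (simp add: gN_eq field_simps)
  next
    case False
    have "u \<notin> {gval p B..y}" for B
      using False gval_ge_1[of B] by auto
    then show ?thesis
      using False by simp
  qed
  ultimately show ?thesis
    by (simp add: right_diff_distrib)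
qed

text \<open>The previous integral with \<open>y = x / gval p A\<close>, weighted by
  \<open>gmoebius A\<close> and summed over \<open>A\<close>. Inside the integral,
  \<open>u \<le> x / gval p A\<close> is the same as \<open>gval p A \<le> x / u\<close>, so the
  weights add up to \<open>gM p e (x / u)\<close>. This vanishes for \<open>u > x\<close>, so no
  upper limit is needed.\<close>

lemma integral_error_gM:
  assumes "x \<ge> 1"
  shows "has_bochner_integral lborel
           (\<lambda>u. indicator {1..} u * ((gN p e u - a * u) / u * gM p e (x / u)))
           (ln x - a * (x * gm p e x - gM p e x))"
proof -
  have "has_bochner_integral lborel
     (\<lambda>u. \<Sum>A\<in>V x. gmoebius A * ((gN p e u - a * u) / u * indicator {1..x / gval p A} u))
     (\<Sum>A\<in>V x. gmoebius A *
        ((\<Sum>B\<in>V (x / gval p A). ln (x / gval p A / gval p B)) - a * (x / gval p A - 1)))"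
    by (intro has_bochner_integral_sum has_bochner_integral_mult_right integral_error_term)
      (auto simp: gval_pos field_simps)
  moreover have "(\<Sum>A\<in>V x. gmoebius A *
        ((\<Sum>B\<in>V (x / gval p A). ln (x / gval p A / gval p B)) - a * (x / gval p A - 1)))
      = ln x - a * (x * gm p e x - gM p e x)"
  proof -
    have "(\<Sum>A\<in>V x. gmoebius A * (a * (x / gval p A - 1))) = a * (x * gm p e x - gM p e x)"
      unfolding gm_eq gM_eq sum_distrib_left sum_subtractf[symmetric]
      by (intro sum.cong) (auto simp: algebra_simps)
    then show ?thesis
      unfolding right_diff_distrib[of "gmoebius _"] sum_subtractf moebius_log_sum[OF assms] by simp
  qed
  moreover have "(\<Sum>A\<in>V x. gmoebius A * ((gN p e u - a * u) / u * indicator {1..x / gval p A} u))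
      = indicator {1..} u * ((gN p e u - a * u) / u * gM p e (x / u))" for u
  proof (cases "u \<ge> 1")
    case True
    have "gval p A * 1 \<le> gval p A * u" for A
      using True gval_pos[of A] by (intro mult_left_mono) auto
    then have "V (x / u) \<subseteq> V x"
      using True by (auto simp: field_simps intro: order_trans)
    moreover have "u \<le> x / gval p A \<longleftrightarrow> gval p A \<le> x / u" for A
      using True gval_pos[of A] by (simp add: field_simps)
    ultimately have "gM p e (x / u) = (\<Sum>A\<in>V x. gmoebius A * indicator {1..x / gval p A} u)"
      unfolding gM_eq using True
      by (intro sum.mono_neutral_cong_left) (auto simp: finite_V)
    then show ?thesis
      using True by (simp add: sum_distrib_left mult_ac)
  qed simp
  ultimately show ?thesis
    by simp
qed

section \<open>Passage to the limit\<close>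

lemma gM_over_id_bounded:
  assumes "gM p e \<in> o[at_top](\<lambda>x. x)"
  obtains C where "\<And>x. x > 0 \<Longrightarrow> \<bar>gM p e x / x\<bar> \<le> C"
proof -
  have "eventually (\<lambda>x. \<bar>gM p e x\<bar> \<le> 1 * \<bar>x\<bar>) at_top"
    using landau_o.smallD[OF assms, of 1] by simp
  then obtain b where b: "\<And>x. x \<ge> b \<Longrightarrow> \<bar>gM p e x\<bar> \<le> \<bar>x\<bar>"
    by (auto simp: eventually_at_top_linorder)
  \<comment> \<open>The \<open>1\<close> serves \<open>x \<ge> b\<close>. On \<open>[1, b]\<close>
    the monotone count \<open>gN\<close> bounds \<open>gM\<close>, and below \<open>1\<close> the
    sum \<open>gM\<close> is empty.\<close>
  have "\<bar>gM p e x / x\<bar> \<le> max 1 (gN p e b)" if "x > 0" for x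
  proof -
    consider "x \<ge> b" | "x < 1" | "1 \<le> x" "x \<le> b"
      by linarith
    then show ?thesis
    proof cases
      case 1
      then show ?thesis
        using b[of x] that by (simp add: abs_divide field_simps le_max_iff_disj)
    next
      case 2
      then show ?thesis
        by (simp add: gM_eq V_empty)
    next
      case 3
      have "\<bar>gM p e x\<bar> \<le> gN p e b"
        using abs_gM_le_gN[of x] monoD[OF mono_gN 3(2)] by linarith
      moreover have "\<bar>gM p e x / x\<bar> \<le> \<bar>gM p e x\<bar>"
        using 3(1) mult_left_mono[of 1 x "\<bar>gM p e x\<bar>"] by (simp add: abs_divide field_simps)
      ultimately show ?thesis
        by linarith
    qed
  qed
  then show ?thesis
    by (rule that)
qed

text \<open>After division by \<open>x\<close> the integrand is an integrable function of
  \<open>u\<close> times \<open>gM p e v / v\<close> at \<open>v = x / u\<close>. The second factor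
  is bounded, and for fixed \<open>u\<close> it tends to 0 as \<open>x\<close> grows, so dominated
  convergence applies.\<close>

lemma error_gM_convolution_tendsto_0:
  assumes int: "set_integrable lborel {1..} (\<lambda>x. \<bar>(gN p e x - a * x) / x\<^sup>2\<bar>)"
    and M: "gM p e \<in> o[at_top](\<lambda>x. x)"
  shows "((\<lambda>x. (ln x - a * (x * gm p e x - gM p e x)) / x) \<longlongrightarrow> 0) at_top"
proof -
  obtain C where C: "\<And>x. x > 0 \<Longrightarrow> \<bar>gM p e x / x\<bar> \<le> C"
    using gM_over_id_bounded[OF M] by blast
  define s where "s x u = indicator {1..} u * ((gN p e u - a * u) / u * gM p e (x / u)) / x"
    for x u :: real
  have s: "has_bochner_integral lborel (s x) ((ln x - a * (x * gm p e x - gM p e x)) / x)"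
    if "x \<ge> 1" for x
    using has_bochner_integral_divide_zero[OF integral_error_gM[OF that, of a], of x]
    by (simp add: s_def[abs_def])
  have s_eq: "s x u = indicator {1..} u * ((gN p e u - a * u) / u\<^sup>2) * (gM p e (x / u) / (x / u))"
    if "x > 0" for x u
    using that by (cases "u \<ge> 1") (auto simp: s_def power2_eq_square)
  \<comment> \<open>The convergence theorem asks for measurability at every \<open>x\<close>, but
    the integral identity supplies it only for \<open>x \<ge> 1\<close>; hence the cutoff.\<close>
  define s' where "s' x u = (if x \<ge> 1 then s x u else 0)" for x u
  have "((\<lambda>x. integral\<^sup>L lborel (s' x)) \<longlongrightarrow> integral\<^sup>L lborel (\<lambda>u :: real. 0 :: real)) at_top"
  proof (rule integral_dominated_convergence_at_top)
    show "s' x \<in> borel_measurable lborel" for x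
      using s[of x] by (cases "x \<ge> 1") (auto simp: s'_def[abs_def] has_bochner_integral_iff)
    show "integrable lborel (\<lambda>u. (indicator {1..} u * \<bar>(gN p e u - a * u) / u\<^sup>2\<bar>) * C)"
      using int unfolding set_integrable_def by (intro integrable_mult_left) simp
    show "eventually (\<lambda>x. AE u in lborel. norm (s' x u)
        \<le> (indicator {1..} u * \<bar>(gN p e u - a * u) / u\<^sup>2\<bar>) * C) at_top"
      using eventually_ge_at_top[of 1]
    proof eventually_elim
      case (elim x)
      have "norm (s' x u) \<le> (indicator {1..} u * \<bar>(gN p e u - a * u) / u\<^sup>2\<bar>) * C" for u
      proof (cases "u \<ge> 1")
        case True
        then have "\<bar>gM p e (x / u) / (x / u)\<bar> \<le> C"
          using elim by (intro C) auto
        then have "\<bar>(gN p e u - a * u) / u\<^sup>2\<bar> * \<bar>gM p e (x / u) / (x / u)\<bar>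
            \<le> \<bar>(gN p e u - a * u) / u\<^sup>2\<bar> * C"
          by (intro mult_left_mono) auto
        moreover have "s' x u = (gN p e u - a * u) / u\<^sup>2 * (gM p e (x / u) / (x / u))"
          using True elim s_eq[of x u] by (simp only: s'_def) simp
        ultimately show ?thesis
          using True by (simp only: real_norm_def abs_mult) simp
      qed (use elim in \<open>simp add: s'_def s_def\<close>)
      then show ?case
        by simp
    qed
    have "((\<lambda>x. s' x u) \<longlongrightarrow> 0) at_top" for u
    proof (cases "u \<ge> 1")
      case True
      have "((\<lambda>v. gM p e v / v) \<longlongrightarrow> 0) at_top"
        using M by (rule smalloD_tendsto)
      moreover have "filterlim (\<lambda>x. x / u) at_top at_top"
        using filterlim_tendsto_pos_mult_at_top[OF tendsto_const[of "1 / u"] _ filterlim_ident] True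
        by simp
      ultimately have "((\<lambda>x. gM p e (x / u) / (x / u)) \<longlongrightarrow> 0) at_top"
        by (rule filterlim_compose)
      then have "((\<lambda>x. indicator {1..} u * ((gN p e u - a * u) / u\<^sup>2) * (gM p e (x / u) / (x / u)))
          \<longlongrightarrow> 0) at_top"
        by (rule tendsto_mult_right_zero)
      then show ?thesis
        by (rule Lim_transform_eventually)
          (use eventually_ge_at_top[of 1] in eventually_elim, simp add: s'_def s_eq)
    qed (simp add: s'_def s_def cong: if_cong)
    then show "AE u in lborel. ((\<lambda>x. s' x u) \<longlongrightarrow> 0) at_top"
      by simp
  qed simp
  moreover have "eventually (\<lambda>x. integral\<^sup>L lborel (s' x)
      = (ln x - a * (x * gm p e x - gM p e x)) / x) at_top"
    using eventually_ge_at_top[of 1]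
  proof eventually_elim
    case (elim x)
    then have "s' x = s x"
      by (simp add: s'_def fun_eq_iff)
    then show ?case
      using has_bochner_integral_integral_eq[OF s[OF elim]] by simp
  qed
  ultimately show ?thesis
    by (simp add: tendsto_cong)
qed

end

theorem theorem1p4:
  fixes p :: "nat \<Rightarrow> real" and e :: "nat \<Rightarrow> nat multiset" and a :: real
  assumes "beurling_primes p"
    and "gint_listing p e"
    and "a > 0"
    and "set_integrable lborel {1..} (\<lambda>x. \<bar>(gN p e x - a * x) / x\<^sup>2\<bar>)"
    and "gM p e \<in> o[at_top](\<lambda>x. x)"
  shows "gm p e \<in> o[at_top](\<lambda>_. 1)"
proof -
  interpret beurling p e
    by unfold_locales fact+
  \<comment> \<open>For \<open>x > 0\<close> this expression is just \<open>gm p e x\<close>,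
    rewritten so that each of its three summands is known to tend to 0.\<close>
  have "((\<lambda>x. (ln x / x - (ln x - a * (x * gm p e x - gM p e x)) / x) / a + gM p e x / x)
      \<longlongrightarrow> (0 - 0) / a + 0) at_top"
    by (intro tendsto_intros error_gM_convolution_tendsto_0 smalloD_tendsto ln_x_over_x_tendsto_0 assms)
      (use \<open>a > 0\<close> in simp)
  moreover have "eventually (\<lambda>x. (ln x / x - (ln x - a * (x * gm p e x - gM p e x)) / x) / a
      + gM p e x / x = gm p e x) at_top"
    using eventually_gt_at_top[of 0]
    by eventually_elim (use \<open>a > 0\<close> in \<open>simp add: field_simps\<close>)
  ultimately have "(gm p e \<longlongrightarrow> 0) at_top"
    by (simp add: tendsto_cong)
  then show ?thesis
    by (intro smalloI_tendsto) auto
qed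

end
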